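(* Let $V$ be a finite vertex set with $|V|=m+1\ge3$ and $N=\binom{|V|}2$. The vectors $\{\boldsymbol\varphi_e:e\in\binom V2\}$ form a unit-norm tight frame for $\mathcal H_{\mathcal K}$. The centered-projector Gram matrix $\boldsymbol G_{\mathcal K}$ has eigenvalue zero on $\boldsymbol 1_N$, and, on $\boldsymbol 1_N^\perp$, the eigenvalues $$\frac{|V|}4\text{ with multiplicity }|V|-1\quad\text{and}\quad\frac12\text{ with multiplicity }\frac{|V|(|V|-3)}2.$$ Consequently, $$\gamma_{\mathcal K}=\begin{cases}3/4,&|V|=3,\\1/2,&|V|\ge4.\end{cases}$$
   Context: $\binom V2$ is the set of two-element subsets of $V$ (the edges of the complete graph $\mathcal K$ on $V$). $\mathcal H_{\mathcal K}=\boldsymbol 1_{|V|}^\perp\subset\mathbb R^{|V|}$ is the $m$-dimensional space of real vectors indexed by $V$ with zero sum. For an edge $e=\{u,v\}$ (with an arbitrarily fixed ordering of its endpoints), $\boldsymbol\varphi_e=(\boldsymbol e_u-\boldsymbol e_v)/\sqrt2\in\mathcal H_{\mathcal K}$, where $\boldsymbol e_u$ denotes the standard unit vector. A family $\{\boldsymbol\varphi_1,\dots,\boldsymbol\varphi_N\}$ in an $m$-dimensional inner product space $\mathcal H$ is a unit-norm tight frame for $\mathcal H$ if $\|\boldsymbol\varphi_i\|_2=1$ for all $i$ and $\sum_{i=1}^N|\langle\boldsymbol a,\boldsymbol\varphi_i\rangle|^2=\frac Nm\|\boldsymbol a\|_2^2$ for all $\boldsymbol a\in\mathcal H$. On $\mathcal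 H_{\mathcal K}$ let $P_e\boldsymbol a=\langle\boldsymbol a,\boldsymbol\varphi_e\rangle\boldsymbol\varphi_e$ and $Q_e=P_e-\frac1m\mathrm{Id}_{\mathcal H_{\mathcal K}}$. The centered-projector Gram matrix is $\boldsymbol G_{\mathcal K}=[\operatorname{trace}(Q_eQ_f)]_{e,f\in\binom V2}\in\mathbb R^{N\times N}$, and $\gamma_{\mathcal K}$ is its smallest eigenvalue on $\boldsymbol 1_N^\perp$, where $\boldsymbol 1_N$ is the all-ones vector. *)

theory Defs
  imports "HOL-Analysis.Analysis" "HOL-Library.Cardinality"
begin

section \<open>Linear algebra on a subspace\<close>

text \<open>A family in a subspace \<open>H\<close>, indexed by a finite type; \<open>m\<close> is \<open>dim H\<close> and \<open>N\<close> is the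
  number of indices (repeated vectors are counted repeatedly).\<close>

definition unit_norm_tight_frame :: "'a::euclidean_space set \<Rightarrow> ('i::finite \<Rightarrow> 'a) \<Rightarrow> bool" where
  "unit_norm_tight_frame H \<phi> \<longleftrightarrow>
     subspace H \<and> range \<phi> \<subseteq> H \<and> (\<forall>i. norm (\<phi> i) = 1) \<and>
     (\<forall>a\<in>H. (\<Sum>i\<in>UNIV. \<bar>a \<bullet> \<phi> i\<bar>\<^sup>2) = real CARD('i) / real (dim H) * (norm a)\<^sup>2)"

definition orthonormal_basis_of :: "'a::euclidean_space set \<Rightarrow> 'a set \<Rightarrow> bool" where
  "orthonormal_basis_of H B \<longleftrightarrow>
     B \<subseteq> H \<and> pairwise orthogonal B \<and> (\<forall>b\<in>B. norm b = 1) \<and> span B = H"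

text \<open>The trace of a linear operator \<open>H \<rightarrow> H\<close>, given as a function on the ambient space of which
  only the values on \<open>H\<close> matter. By \<open>trace_on_eq\<close> below, the choice of basis is irrelevant.\<close>

definition trace_on :: "'a::euclidean_space set \<Rightarrow> ('a \<Rightarrow> 'a) \<Rightarrow> real" where
  "trace_on H T = (\<Sum>b\<in>(SOME B. orthonormal_basis_of H B). T b \<bullet> b)"

lemma orthonormal_basis_of_finite:
  assumes "orthonormal_basis_of H B"
  shows "finite B"
proof -
  have "0 \<notin> B"
    using assms by (auto simp: orthonormal_basis_of_def)
  then have "independent B"
    using assms by (intro pairwise_orthogonal_independent) (auto simp: orthonormal_basis_of_def)
  then show ?thesis
    by (rule independent_imp_finite)
qed

lemma orthonormal_basis_of_expand:
  assumes "orthonormal_basis_of H B" and "x \<in> H"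
  shows "(\<Sum>b\<in>B. (x \<bullet> b) *\<^sub>R b) = x"
  using assms orthonormal_basis_of_finite[OF assms(1)]
  by (intro orthonormal_basis_expand) (auto simp: orthonormal_basis_of_def)

lemma orthonormal_basis_of_exists:
  assumes "subspace H"
  shows "\<exists>B. orthonormal_basis_of H B"
  using orthonormal_basis_subspace[OF assms] unfolding orthonormal_basis_of_def by metis

lemma trace_on_eq:
  assumes T: "linear T" and B: "orthonormal_basis_of H B"
  shows "trace_on H T = (\<Sum>b\<in>B. T b \<bullet> b)"
proof -
  define C where "C = (SOME C. orthonormal_basis_of H C)"
  have C: "orthonormal_basis_of H C"
    unfolding C_def using B by (rule someI)
  have BH: "B \<subseteq> H" and CH: "C \<subseteq> H"
    using B C by (auto simp: orthonormal_basis_of_def)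
  have "(\<Sum>c\<in>C. T c \<bullet> c) = (\<Sum>c\<in>C. T (\<Sum>b\<in>B. (c \<bullet> b) *\<^sub>R b) \<bullet> c)"
    using orthonormal_basis_of_expand[OF B] CH by (intro sum.cong) auto
  also have "\<dots> = (\<Sum>c\<in>C. \<Sum>b\<in>B. T b \<bullet> ((b \<bullet> c) *\<^sub>R c))"
    using T by (intro sum.cong refl)
      (simp add: linear_sum linear_cmul inner_sum_left, simp add: inner_commute)
  also have "\<dots> = (\<Sum>b\<in>B. T b \<bullet> (\<Sum>c\<in>C. (b \<bullet> c) *\<^sub>R c))"
    by (subst sum.swap) (simp add: inner_sum_right)
  also have "\<dots> = (\<Sum>b\<in>B. T b \<bullet> b)"
    using orthonormal_basis_of_expand[OF C] BH by (intro sum.cong) auto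
  finally show ?thesis
    by (simp add: trace_on_def C_def)
qed

definition rank_one_proj :: "'a::euclidean_space \<Rightarrow> 'a \<Rightarrow> 'a" where
  "rank_one_proj \<phi> a = (a \<bullet> \<phi>) *\<^sub>R \<phi>"

definition centered_proj :: "'a::euclidean_space set \<Rightarrow> 'a \<Rightarrow> 'a \<Rightarrow> 'a" where
  "centered_proj H \<phi> a = rank_one_proj \<phi> a - (1 / real (dim H)) *\<^sub>R a"

definition centered_gram ::
  "'a::euclidean_space set \<Rightarrow> ('i::finite \<Rightarrow> 'a) \<Rightarrow> real^'i^'i" where
  "centered_gram H \<phi> =
     (\<chi> i j. trace_on H (centered_proj H (\<phi> i) \<circ> centered_proj H (\<phi> j)))"

definition eigenspace_on :: "(real^'i)^'i::finite \<Rightarrow> (real^'i) set \<Rightarrow> real \<Rightarrow> (real^'i) set" where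
  "eigenspace_on A W \<mu> = {x \<in> W. A *v x = \<mu> *\<^sub>R x}"

definition eigenvalues_on :: "(real^'i)^'i::finite \<Rightarrow> (real^'i) set \<Rightarrow> real set" where
  "eigenvalues_on A W = {\<mu>. \<exists>x\<in>eigenspace_on A W \<mu>. x \<noteq> 0}"

text \<open>Geometric multiplicity. It equals the algebraic one for a symmetric matrix, such as a Gram
  matrix, restricted to an invariant subspace.\<close>

definition multiplicity_on :: "(real^'i)^'i::finite \<Rightarrow> (real^'i) set \<Rightarrow> real \<Rightarrow> nat" where
  "multiplicity_on A W \<mu> = dim (eigenspace_on A W \<mu>)"

definition ones :: "real^'i::finite" where
  "ones = (\<chi> i. 1)"


section \<open>The complete graph\<close>

text \<open>The vertex set is the type \<open>'v\<close>; the sort \<open>card2\<close> (finite with at least two elements) makes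
  the set of edges nonempty.\<close>

typedef ('v::card2) edge = "{e :: 'v set. card e = 2}"
  morphisms endpoints Edge
proof -
  have "2 \<le> CARD('v)"
    by (rule two_le_card)
  then obtain e :: "'v set" where "card e = 2"
    by (meson obtain_subset_with_card_n)
  then show ?thesis
    by auto
qed

instance edge :: (card2) finite
proof
  have "finite (range (endpoints :: 'a edge \<Rightarrow> 'a set))"
    by (rule finite_subset[OF subset_UNIV]) simp
  then show "finite (UNIV :: 'a edge set)"
    by (rule finite_imageD) (simp add: inj_def endpoints_inject)
qed

lemma card_edge: "CARD('v::card2 edge) = CARD('v) choose 2"
proof -
  have "CARD('v edge) = card {e :: 'v set. card e = 2}"
    using type_definition.card[OF type_definition_edge] .
  also have "\<dots> = card {e. e \<subseteq> (UNIV :: 'v set) \<and> card e = 2}"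
    by simp
  also have "\<dots> = CARD('v) choose 2"
    by (rule n_subsets) simp
  finally show ?thesis .
qed

definition HK :: "(real^'v::finite) set" where
  "HK = {ones}\<^sup>\<bottom>"

lemma mem_HK_iff: "x \<in> HK \<longleftrightarrow> (\<Sum>v\<in>UNIV. x $ v) = 0"
  by (simp add: HK_def orthogonal_comp_def orthogonal_def ones_def inner_vec_def)

lemma dim_HK: "dim (HK :: (real^'v::finite) set) = CARD('v) - 1"
proof -
  have "(HK :: (real^'v) set) = {x. ones \<bullet> x = 0}"
    by (auto simp: HK_def orthogonal_comp_def orthogonal_def)
  moreover have "(ones :: real^'v) \<noteq> 0"
    by (simp add: ones_def vec_eq_iff)
  ultimately show ?thesis
    using dim_hyperplane[of "ones :: real^'v"] by simp
qed

definition is_orientation :: "('v::card2 edge \<Rightarrow> 'v \<times> 'v) \<Rightarrow> bool" where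
  "is_orientation \<sigma> \<longleftrightarrow> (\<forall>e. endpoints e = {fst (\<sigma> e), snd (\<sigma> e)})"

definition edge_vec :: "('v::card2 edge \<Rightarrow> 'v \<times> 'v) \<Rightarrow> 'v edge \<Rightarrow> real^('v::card2)" where
  "edge_vec \<sigma> e = (1 / sqrt 2) *\<^sub>R (axis (fst (\<sigma> e)) 1 - axis (snd (\<sigma> e)) 1)"

definition GK :: "('v::card2 edge \<Rightarrow> 'v \<times> 'v) \<Rightarrow> real^('v edge)^('v edge)" where
  "GK \<sigma> = centered_gram HK (edge_vec \<sigma>)"

text \<open>The set of eigenvalues of a matrix is finite, so \<open>Min\<close> is meaningful here.\<close>

definition gammaK :: "('v::card2 edge \<Rightarrow> 'v \<times> 'v) \<Rightarrow> real" where
  "gammaK \<sigma> = Min (eigenvalues_on (GK \<sigma>) ({ones}\<^sup>\<bottom>))"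

end

theory Submission
  imports Defs
begin

text \<open>
  Let \<open>M\<close> be the vertex-edge incidence matrix of the complete graph on \<open>n\<close> vertices and
  \<open>m = n - 1\<close>. Two edges \<open>e\<close>, \<open>f\<close> satisfy
  \<open>4 (\<phi>\<^sub>e \<bullet> \<phi>\<^sub>f)\<^sup>2 = (card (e \<inter> f))\<^sup>2 = card (e \<inter> f) + 2 [e = f]\<close>, because
  \<open>k\<^sup>2 = k\<close> for \<open>k = 0, 1\<close> and \<open>2\<^sup>2 = 2 + 2\<close>; the orientation disappears in the square. As
  \<open>trace (Q\<^sub>e Q\<^sub>f) = (\<phi>\<^sub>e \<bullet> \<phi>\<^sub>f)\<^sup>2 - 1/m\<close> (lemma \<open>centered_gram_entry\<close>), writing \<open>J\<close> for the
  all-ones matrix,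
  \<open>G = (M\<^sup>T M + 2 I) / 4 - J / m\<close> (lemma \<open>GK_mult_vec\<close>).

  On the other side, \<open>M M\<^sup>T = (n - 2) I + J\<close> (lemma \<open>incidence_mult_transpose\<close>): each vertex has
  degree \<open>n - 1\<close> and two vertices lie on exactly one common edge. So on the vectors of zero sum,
  where \<open>J\<close> vanishes, \<open>G\<close> acts as \<open>(M\<^sup>T M + 2 I) / 4\<close>, and \<open>M\<^sup>T M\<close> has there at most the
  eigenvalues \<open>n - 2\<close> and \<open>0\<close>, which are distinct as \<open>n \<ge> 3\<close>. The first one has as eigenspace
  the injective image under \<open>M\<^sup>T\<close> of the \<open>(n - 1)\<close>-dimensional space \<open>HK\<close>; the second one has
  the kernel of \<open>M\<close>, that is, the orthogonal complement of the \<open>n\<close>-dimensional range of \<open>M\<^sup>T\<close>.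
  For \<open>G\<close> they become \<open>n / 4\<close> with multiplicity \<open>n - 1\<close>, and \<open>1 / 2\<close> with multiplicity
  \<open>n (n - 1) / 2 - n = n (n - 3) / 2\<close>, which is \<open>0\<close> exactly for \<open>n = 3\<close>.

  The tight frame identity is a consequence of the same formula for \<open>M M\<^sup>T\<close>, through
  \<open>(a\<^sub>u - a\<^sub>v)\<^sup>2 = 2 (a\<^sub>u\<^sup>2 + a\<^sub>v\<^sup>2) - (a\<^sub>u + a\<^sub>v)\<^sup>2\<close>.
\<close>

section \<open>The centered-projector Gram matrix of unit vectors\<close>

lemma orthonormal_basis_of_card:
  assumes "orthonormal_basis_of H B"
  shows "card B = dim H"
proof -
  have "independent B"
    using assms by (intro pairwise_orthogonal_independent) (auto simp: orthonormal_basis_of_def)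
  then show ?thesis
    using assms dim_span[of B] dim_eq_card_independent[of B]
    by (simp add: orthonormal_basis_of_def)
qed

lemma orthonormal_basis_of_parseval:
  assumes "orthonormal_basis_of H B" and "x \<in> H"
  shows "(\<Sum>b\<in>B. (x \<bullet> b) * (y \<bullet> b)) = x \<bullet> y"
proof -
  have "x \<bullet> y = (\<Sum>b\<in>B. (x \<bullet> b) *\<^sub>R b) \<bullet> y"
    using orthonormal_basis_of_expand[OF assms] by simp
  also have "\<dots> = (\<Sum>b\<in>B. (x \<bullet> b) * (y \<bullet> b))"
    by (simp add: inner_sum_left inner_commute[of y])
  finally show ?thesis ..
qed

lemma linear_centered_proj: "linear (centered_proj H \<phi>)"
  by (rule linearI)
    (simp_all add: centered_proj_def rank_one_proj_def inner_add_left algebra_simps)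

text \<open>In an orthonormal basis of \<open>H\<close>, Parseval's identity turns the four terms of
  \<open>trace (Q\<^sub>i Q\<^sub>j)\<close> into \<open>(\<phi>\<^sub>i \<bullet> \<phi>\<^sub>j)\<^sup>2\<close>, twice \<open>- 1 / dim H\<close>, and \<open>1 / dim H\<close>.\<close>

lemma centered_gram_entry:
  fixes \<phi> :: "'i::finite \<Rightarrow> 'a::euclidean_space"
  assumes "subspace H" and "dim H > 0"
    and "\<phi> i \<in> H" "norm (\<phi> i) = 1" "\<phi> j \<in> H" "norm (\<phi> j) = 1"
  shows "centered_gram H \<phi> $ i $ j = (\<phi> i \<bullet> \<phi> j)\<^sup>2 - 1 / real (dim H)"
proof -
  obtain B where B: "orthonormal_basis_of H B"
    using orthonormal_basis_of_exists[OF assms(1)] by blast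
  define c where "c = 1 / real (dim H)"
  let ?T = "centered_proj H (\<phi> i) \<circ> centered_proj H (\<phi> j)"
  have 1: "b \<bullet> b = 1" if "b \<in> B" for b
    using B that by (auto simp: orthonormal_basis_of_def norm_eq_1)
  have "?T b \<bullet> b = (\<phi> i \<bullet> \<phi> j) * ((\<phi> i \<bullet> b) * (\<phi> j \<bullet> b)) - c * ((\<phi> i \<bullet> b) * (\<phi> i \<bullet> b))
      - c * ((\<phi> j \<bullet> b) * (\<phi> j \<bullet> b)) + c\<^sup>2" if "b \<in> B" for b
    using 1[OF that]
    by (simp add: centered_proj_def rank_one_proj_def c_def[symmetric] inner_diff_left
        inner_commute algebra_simps power2_eq_square)
  then have "(\<Sum>b\<in>B. ?T b \<bullet> b) =
      (\<Sum>b\<in>B. (\<phi> i \<bullet> \<phi> j) * ((\<phi> i \<bullet> b) * (\<phi> j \<bullet> b)) - c * ((\<phi> i \<bullet> b) * (\<phi> i \<bullet> b))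
      - c * ((\<phi> j \<bullet> b) * (\<phi> j \<bullet> b)) + c\<^sup>2)"
    by (intro sum.cong) auto
  also have "\<dots> = (\<phi> i \<bullet> \<phi> j) * (\<phi> i \<bullet> \<phi> j) - c * (\<phi> i \<bullet> \<phi> i) - c * (\<phi> j \<bullet> \<phi> j)
      + real (dim H) * c\<^sup>2"
    by (simp add: sum.distrib sum_subtractf sum_distrib_left[symmetric] assms
        orthonormal_basis_of_parseval[OF B] orthonormal_basis_of_card[OF B])
  also have "\<dots> = (\<phi> i \<bullet> \<phi> j)\<^sup>2 - c"
    using assms by (simp add: norm_eq_1 c_def power2_eq_square)
  finally show ?thesis
    using trace_on_eq[OF linear_compose[OF linear_centered_proj linear_centered_proj] B]
    by (simp add: centered_gram_def c_def)
qed

section \<open>The incidence matrix of the complete graph\<close>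

text \<open>The matrix \<open>M\<close>. Rows are indexed by vertices and columns by edges. For a vector \<open>x\<close> on edges, \<open>M *v x\<close> sums
  \<open>x\<close> over the edges at each vertex; for a vector \<open>y\<close> on vertices, \<open>y v* M\<close> sums \<open>y\<close> over the
  two endpoints of each edge.\<close>

definition incidence_matrix :: "real^('v edge)^('v::card2)" where
  "incidence_matrix = (\<chi> v e. of_bool (v \<in> endpoints e))"

lemma endpoints_cases:
  obtains u v where "endpoints e = {u, v}" "u \<noteq> v"
  using endpoints[of e] by (auto simp: card_2_iff)

lemma ex1_edge_with_endpoints:
  fixes u v :: "'v::card2"
  assumes "u \<noteq> v"
  shows "\<exists>!e. u \<in> endpoints e \<and> v \<in> endpoints e"
proof -
  have iff: "u \<in> endpoints e \<and> v \<in> endpoints e \<longleftrightarrow> endpoints e = {u, v}" for e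
    using endpoints[of e] assms by (auto simp: card_2_iff)
  have "endpoints (Edge {u, v}) = {u, v}"
    using assms by (simp add: Edge_inverse)
  then show ?thesis
    unfolding iff by (metis endpoints_inject)
qed

lemma incidence_rows_inner:
  fixes u v :: "'v::card2"
  shows "(\<Sum>e\<in>UNIV. incidence_matrix $ u $ e * incidence_matrix $ v $ e)
    = (if u = v then real CARD('v) - 1 else 1)"
proof -
  have off: "(\<Sum>e\<in>UNIV. incidence_matrix $ u $ e * incidence_matrix $ w $ e) = (1 :: real)"
    if uw: "u \<noteq> w" for w :: 'v
  proof -
    obtain e0 where "\<And>e. u \<in> endpoints e \<and> w \<in> endpoints e \<longleftrightarrow> e = e0"
      using ex1_edge_with_endpoints[OF uw] by metis
    then show ?thesis
      by (simp add: incidence_matrix_def of_bool_conj[symmetric])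
  qed
  show ?thesis
  proof (cases "u = v")
    case True
    \<comment> \<open>Every edge at \<open>u\<close> has exactly one further endpoint \<open>w\<close>, so the degree of \<open>u\<close> is the sum
      of the off-diagonal row products.\<close>
    have other: "(\<Sum>w\<in>UNIV - {u}. incidence_matrix $ u $ e * incidence_matrix $ w $ e)
        = incidence_matrix $ u $ e * (incidence_matrix $ u $ e :: real)" for e
    proof (cases "u \<in> endpoints e")
      case True
      then obtain w where w: "endpoints e = {u, w}" "u \<noteq> w"
        using endpoints_cases[of e] by (metis doubleton_eq_iff insertE singletonD)
      then have "(UNIV - {u}) \<inter> endpoints e = {w}"
        by auto
      then show ?thesis
        using True by (simp add: incidence_matrix_def sum_of_bool_eq Int_def)
    qed (simp add: incidence_matrix_def)
    have "(\<Sum>e\<in>UNIV. incidence_matrix $ u $ e * incidence_matrix $ u $ e) =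
        (\<Sum>e\<in>UNIV. \<Sum>w\<in>UNIV - {u}. incidence_matrix $ u $ e * (incidence_matrix $ w $ e :: real))"
      using other by simp
    also have "\<dots> = (\<Sum>w\<in>UNIV - {u}. 1)"
      by (subst sum.swap) (intro sum.cong refl off, auto)
    also have "\<dots> = real CARD('v) - 1"
      by (simp add: card_Diff_singleton of_nat_diff Suc_leI)
    finally show ?thesis
      using True by simp
  qed (use off in auto)
qed

lemma incidence_mult_transpose:
  fixes y :: "real^('v::card2)"
  shows "incidence_matrix *v (y v* incidence_matrix) =
    (real CARD('v) - 2) *\<^sub>R y + (ones \<bullet> y) *\<^sub>R ones"
proof (rule vec_eq_iff[THEN iffD2], rule allI)
  fix u :: 'v
  have "(incidence_matrix *v (y v* incidence_matrix)) $ u =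
      (\<Sum>e\<in>UNIV. \<Sum>v\<in>UNIV. incidence_matrix $ u $ e * incidence_matrix $ v $ e * y $ v)"
    by (simp add: matrix_vector_mult_def vector_matrix_mult_def sum_distrib_left mult_ac)
  also have "\<dots> = (\<Sum>v\<in>UNIV. (\<Sum>e\<in>UNIV. incidence_matrix $ u $ e * incidence_matrix $ v $ e) * y $ v)"
    by (subst sum.swap) (simp add: sum_distrib_right)
  also have "\<dots> = (\<Sum>v\<in>UNIV. (if u = v then (real CARD('v) - 2) * y $ v else 0) + y $ v)"
    by (intro sum.cong) (auto simp: incidence_rows_inner algebra_simps)
  also have "\<dots> = ((real CARD('v) - 2) *\<^sub>R y + (ones \<bullet> y) *\<^sub>R ones) $ u"
    by (simp add: sum.distrib ones_def inner_vec_def)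
  finally show "(incidence_matrix *v (y v* incidence_matrix)) $ u =
      ((real CARD('v) - 2) *\<^sub>R y + (ones \<bullet> y) *\<^sub>R ones) $ u" .
qed

lemma vec_mult_incidence_nth:
  assumes "endpoints e = {u, v}" "u \<noteq> v"
  shows "(y v* incidence_matrix) $ e = y $ u + y $ v"
proof -
  have "(y v* incidence_matrix) $ e = (\<Sum>w\<in>endpoints e. y $ w)"
    by (simp add: vector_matrix_mult_def incidence_matrix_def)
  then show ?thesis
    using assms by simp
qed

lemma ones_mult_incidence: "ones v* incidence_matrix = 2 *\<^sub>R ones"
proof (rule vec_eq_iff[THEN iffD2], rule allI)
  fix e :: "'a edge"
  show "(ones v* incidence_matrix) $ e = (2 *\<^sub>R ones) $ e"
    by (rule endpoints_cases[of e]) (simp add: vec_mult_incidence_nth, simp add: ones_def)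
qed

lemma ones_inner_ones: "(ones :: real^'i::finite) \<bullet> ones = real CARD('i)"
  by (simp add: ones_def inner_vec_def)

lemma incidence_mult_ones:
  "incidence_matrix *v ones = (real CARD('v::card2) - 1) *\<^sub>R (ones :: real^('v::card2))"
proof -
  \<comment> \<open>The all-ones vector on edges is half the image under \<open>M\<^sup>T\<close> of the one on vertices.\<close>
  have "2 *\<^sub>R (incidence_matrix *v ones) =
      incidence_matrix *v (ones v* incidence_matrix :: real^('v edge))"
    by (simp add: ones_mult_incidence matrix_vector_mult_scaleR)
  also have "\<dots> = 2 *\<^sub>R ((real CARD('v) - 1) *\<^sub>R (ones :: real^('v::card2)))"
    by (simp add: incidence_mult_transpose ones_inner_ones flip: scaleR_add_left)
  finally show ?thesis
    unfolding scaleR_cancel_left by simp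
qed

lemma ones_inner_incidence_mult:
  "ones \<bullet> (incidence_matrix *v x) = 2 * (ones \<bullet> x)"
  by (simp add: dot_lmul_matrix[symmetric] ones_mult_incidence)

lemma ones_inner_mult_incidence:
  "ones \<bullet> (y v* incidence_matrix) = (real CARD('v::card2) - 1) * ((ones :: real^('v::card2)) \<bullet> y)"
  by (simp add: inner_commute[of ones] dot_lmul_matrix incidence_mult_ones)

lemma mem_ones_perp_iff: "x \<in> {ones}\<^sup>\<bottom> \<longleftrightarrow> ones \<bullet> x = 0"
  by (simp add: orthogonal_comp_def orthogonal_def)

lemma incidence_gram_zero_iff:
  "(incidence_matrix *v x) v* incidence_matrix = 0 \<longleftrightarrow> incidence_matrix *v x = 0"
proof
  assume "(incidence_matrix *v x) v* incidence_matrix = 0"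
  then have "(incidence_matrix *v x) \<bullet> (incidence_matrix *v x) = 0"
    by (simp add: dot_lmul_matrix[symmetric])
  then show "incidence_matrix *v x = 0"
    by simp
qed simp

section \<open>The frame of the complete graph\<close>

lemma orientation_endpoints:
  assumes "is_orientation \<sigma>"
  shows "endpoints e = {fst (\<sigma> e), snd (\<sigma> e)}" "fst (\<sigma> e) \<noteq> snd (\<sigma> e)"
proof -
  show *: "endpoints e = {fst (\<sigma> e), snd (\<sigma> e)}"
    using assms by (simp add: is_orientation_def)
  show "fst (\<sigma> e) \<noteq> snd (\<sigma> e)"
    using endpoints[of e] by (auto simp: * card_insert_if split: if_splits)
qed

lemma subspace_HK: "subspace HK"
  by (simp add: HK_def subspace_orthogonal_comp)

lemma edge_vec_in_HK: "edge_vec \<sigma> e \<in> HK"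
  by (simp add: mem_HK_iff edge_vec_def axis_def sum_subtractf flip: sum_divide_distrib)

lemma inner_edge_vec: "a \<bullet> edge_vec \<sigma> e = (a $ fst (\<sigma> e) - a $ snd (\<sigma> e)) / sqrt 2"
  by (simp add: edge_vec_def inner_diff_right inner_axis)

lemma inner_edge_vec_square:
  fixes \<sigma> :: "'v::card2 edge \<Rightarrow> 'v \<times> 'v"
  assumes "is_orientation \<sigma>"
  shows "4 * (edge_vec \<sigma> e \<bullet> edge_vec \<sigma> f)\<^sup>2 =
    (\<Sum>v\<in>UNIV. incidence_matrix $ v $ e * incidence_matrix $ v $ f) + 2 * of_bool (e = f)"
proof -
  \<comment> \<open>With both orientations spelled out, each side depends only on which of the four endpoints
    coincide.\<close>
  obtain a b c d where \<sigma>: "\<sigma> e = (a, b)" "\<sigma> f = (c, d)"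
    by fastforce
  then have e: "endpoints e = {a, b}" "a \<noteq> b" and f: "endpoints f = {c, d}" "c \<noteq> d"
    using orientation_endpoints[OF assms, of e] orientation_endpoints[OF assms, of f] by auto
  have eq: "e = f \<longleftrightarrow> a = c \<and> b = d \<or> a = d \<and> b = c"
    using e f by (simp add: endpoints_inject[symmetric] doubleton_eq_iff)
  have "(\<Sum>v\<in>UNIV. incidence_matrix $ v $ e * incidence_matrix $ v $ f) =
      (((\<chi> v. incidence_matrix $ v $ e) :: real^('v::card2)) v* incidence_matrix) $ f"
    by (simp add: vector_matrix_mult_def mult.commute)
  also have "\<dots> = of_bool (c \<in> {a, b}) + of_bool (d \<in> {a, b})"
    by (subst vec_mult_incidence_nth[OF f]) (simp add: incidence_matrix_def e)
  finally have sum: "(\<Sum>v\<in>UNIV. incidence_matrix $ v $ e * incidence_matrix $ v $ f) =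
      (of_bool (c \<in> {a, b}) + of_bool (d \<in> {a, b}) :: real)" .
  have "2 * (edge_vec \<sigma> e \<bullet> edge_vec \<sigma> f) =
      of_bool (a = c) - of_bool (b = c) - (of_bool (a = d) - of_bool (b = d))"
    unfolding inner_edge_vec using \<sigma> by (simp add: edge_vec_def axis_def field_simps)
  moreover have "4 * (edge_vec \<sigma> e \<bullet> edge_vec \<sigma> f)\<^sup>2 = (2 * (edge_vec \<sigma> e \<bullet> edge_vec \<sigma> f))\<^sup>2"
    by (simp add: power_mult_distrib)
  ultimately have "4 * (edge_vec \<sigma> e \<bullet> edge_vec \<sigma> f)\<^sup>2 =
      (of_bool (a = c) - of_bool (b = c) - (of_bool (a = d) - of_bool (b = d)))\<^sup>2"
    by simp
  then show ?thesis
    unfolding sum eq using e(2) f(2) by (auto simp: power2_eq_square)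
qed

lemma norm_edge_vec:
  assumes "is_orientation \<sigma>"
  shows "norm (edge_vec \<sigma> e) = 1"
proof -
  have "edge_vec \<sigma> e \<bullet> edge_vec \<sigma> e = (1 / sqrt 2 - (- 1 / sqrt 2)) / sqrt 2"
    unfolding inner_edge_vec using orientation_endpoints(2)[OF assms, of e]
    by (simp add: edge_vec_def axis_def)
  then show ?thesis
    by (simp add: norm_eq_1)
qed

lemma CARD_edge_real: "real CARD('v::card2 edge) = real CARD('v) * (real CARD('v) - 1) / 2"
proof -
  have "CARD('v) \<ge> 2"
    by (rule two_le_card)
  then show ?thesis
    by (simp add: card_edge choose_two real_of_nat_div of_nat_diff)
qed

lemma unit_norm_tight_frame_edge_vec:
  fixes \<sigma> :: "'v::card2 edge \<Rightarrow> 'v \<times> 'v"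
  assumes "is_orientation \<sigma>"
  shows "unit_norm_tight_frame HK (edge_vec \<sigma>)"
proof -
  have n: "CARD('v) \<ge> 2"
    by (rule two_le_card)
  have "(\<Sum>e\<in>UNIV. \<bar>a \<bullet> edge_vec \<sigma> e\<bar>\<^sup>2) =
      real CARD('v edge) / real (dim (HK :: (real^('v::card2)) set)) * (norm a)\<^sup>2"
    if "a \<in> HK" for a
  proof -
    define a2 :: "real^('v::card2)" where "a2 = (\<chi> v. (a $ v)\<^sup>2)"
    have a: "ones \<bullet> a = 0"
      using that by (simp add: HK_def mem_ones_perp_iff)
    have "\<bar>a \<bullet> edge_vec \<sigma> e\<bar>\<^sup>2 =
        (a2 v* incidence_matrix) $ e - ((a v* incidence_matrix) $ e)\<^sup>2 / 2" for e
      using orientation_endpoints[OF assms, of e]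
      by (simp add: vec_mult_incidence_nth inner_edge_vec a2_def power_divide)
        (simp add: power2_eq_square field_simps)
    then have "(\<Sum>e\<in>UNIV. \<bar>a \<bullet> edge_vec \<sigma> e\<bar>\<^sup>2) =
        ones \<bullet> (a2 v* incidence_matrix) - (a v* incidence_matrix) \<bullet> (a v* incidence_matrix) / 2"
      by (simp add: sum_subtractf sum_divide_distrib inner_vec_def ones_def power2_eq_square)
    also have "\<dots> = (real CARD('v) - 1) * (ones \<bullet> a2) - (real CARD('v) - 2) * (a \<bullet> a) / 2"
      by (simp add: ones_inner_mult_incidence dot_lmul_matrix incidence_mult_transpose a)
    also have "ones \<bullet> a2 = a \<bullet> a"
      by (simp add: inner_vec_def ones_def a2_def power2_eq_square)
    finally show ?thesis
      using n by (simp add: CARD_edge_real dim_HK of_nat_diff power2_norm_eq_inner field_simps)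
  qed
  then show ?thesis
    using subspace_HK edge_vec_in_HK norm_edge_vec[OF assms]
    by (auto simp: unit_norm_tight_frame_def)
qed

section \<open>The spectrum of the Gram matrix\<close>

lemma GK_mult_vec:
  fixes \<sigma> :: "'v::card2 edge \<Rightarrow> 'v \<times> 'v"
  assumes "is_orientation \<sigma>"
  shows "GK \<sigma> *v x = (1 / 4) *\<^sub>R ((incidence_matrix *v x) v* incidence_matrix) + (1 / 2) *\<^sub>R x
    - ((ones \<bullet> x) / (real CARD('v) - 1)) *\<^sub>R ones"
proof (rule vec_eq_iff[THEN iffD2], rule allI)
  fix e :: "'v edge"
  let ?M = "incidence_matrix :: real^('v edge)^('v::card2)"
  have n: "CARD('v) \<ge> 2"
    by (rule two_le_card)
  have entry: "GK \<sigma> $ e $ f =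
      (\<Sum>v\<in>UNIV. ?M $ v $ e * ?M $ v $ f) / 4 + of_bool (e = f) / 2 - 1 / (real CARD('v) - 1)" for f
  proof -
    have "GK \<sigma> $ e $ f =
        (edge_vec \<sigma> e \<bullet> edge_vec \<sigma> f)\<^sup>2 - 1 / real (dim (HK :: (real^('v::card2)) set))"
      unfolding GK_def using n
      by (intro centered_gram_entry subspace_HK edge_vec_in_HK norm_edge_vec assms)
        (simp_all add: dim_HK)
    then show ?thesis
      using inner_edge_vec_square[OF assms, of e f] n by (simp add: dim_HK of_nat_diff)
  qed
  have "(GK \<sigma> *v x) $ e = (\<Sum>f\<in>UNIV. (\<Sum>v\<in>UNIV. ?M $ v $ e * ?M $ v $ f * x $ f) / 4
      + (if e = f then x $ f / 2 else 0) - x $ f / (real CARD('v) - 1))"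
    by (auto simp: matrix_vector_mult_def entry distrib_right left_diff_distrib sum_distrib_right
        intro!: sum.cong)
  also have "\<dots> = (\<Sum>f\<in>UNIV. \<Sum>v\<in>UNIV. ?M $ v $ e * ?M $ v $ f * x $ f) / 4 + x $ e / 2
      - (\<Sum>f\<in>UNIV. x $ f) / (real CARD('v) - 1)"
    by (simp add: sum.distrib sum_subtractf sum_divide_distrib)
  also have "(\<Sum>f\<in>UNIV. \<Sum>v\<in>UNIV. ?M $ v $ e * ?M $ v $ f * x $ f) =
      ((?M *v x) v* ?M) $ e"
    by (subst sum.swap)
      (simp add: matrix_vector_mult_def vector_matrix_mult_def sum_distrib_left mult_ac)
  finally show "(GK \<sigma> *v x) $ e = ((1 / 4) *\<^sub>R ((?M *v x) v* ?M) + (1 / 2) *\<^sub>R x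
      - ((ones \<bullet> x) / (real CARD('v) - 1)) *\<^sub>R ones) $ e"
    by (simp add: ones_def inner_vec_def)
qed

text \<open>The eigenvalue equation of \<open>GK\<close> on vectors of zero sum, as one for \<open>M\<^sup>T M\<close>.\<close>

lemma eigenspace_GK_iff:
  fixes \<sigma> :: "'v::card2 edge \<Rightarrow> 'v \<times> 'v"
  assumes "is_orientation \<sigma>"
  shows "x \<in> eigenspace_on (GK \<sigma>) ({ones}\<^sup>\<bottom>) \<mu> \<longleftrightarrow> ones \<bullet> x = 0 \<and>
    (incidence_matrix *v x) v* incidence_matrix = (4 * \<mu> - 2) *\<^sub>R x"
proof -
  let ?y = "(incidence_matrix *v x) v* incidence_matrix"
  have "(1 / 4) *\<^sub>R ?y + (1 / 2) *\<^sub>R x = \<mu> *\<^sub>R x \<longleftrightarrow> ?y = (4 * \<mu> - 2) *\<^sub>R x"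
    by (auto simp: vec_eq_iff field_simps)
  moreover have "GK \<sigma> *v x = (1 / 4) *\<^sub>R ?y + (1 / 2) *\<^sub>R x" if "ones \<bullet> x = 0"
    using that by (simp add: GK_mult_vec[OF assms])
  ultimately show ?thesis
    unfolding eigenspace_on_def mem_ones_perp_iff mem_Collect_eq by metis
qed

lemma eigenvalues_GK_subset:
  fixes \<sigma> :: "'v::card2 edge \<Rightarrow> 'v \<times> 'v"
  assumes "is_orientation \<sigma>"
  shows "eigenvalues_on (GK \<sigma>) ({ones}\<^sup>\<bottom>) \<subseteq> {real CARD('v) / 4, 1 / 2}"
proof
  fix \<mu> assume "\<mu> \<in> eigenvalues_on (GK \<sigma>) ({ones}\<^sup>\<bottom>)"
  then obtain x :: "real^('v edge)" where x: "x \<noteq> 0" "ones \<bullet> x = 0"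
    "(incidence_matrix *v x) v* incidence_matrix = (4 * \<mu> - 2) *\<^sub>R x"
    by (auto simp: eigenvalues_on_def eigenspace_GK_iff[OF assms])
  define y :: "real^('v::card2)" where "y = incidence_matrix *v x"
  \<comment> \<open>Applying \<open>M\<close> to the eigenvalue equation of \<open>M\<^sup>T M\<close> gives one for \<open>M M\<^sup>T\<close>.\<close>
  have "(real CARD('v) - 2) *\<^sub>R y = incidence_matrix *v (y v* incidence_matrix)"
    using x(2) by (simp add: incidence_mult_transpose y_def ones_inner_incidence_mult)
  also have "\<dots> = (4 * \<mu> - 2) *\<^sub>R y"
    by (simp add: y_def x(3) matrix_vector_mult_scaleR)
  finally have "real CARD('v) - 2 = 4 * \<mu> - 2 \<or> y = 0"
    by simp
  moreover have "4 * \<mu> - 2 = 0" if "y = 0"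
    using x that by (simp add: y_def)
  ultimately show "\<mu> \<in> {real CARD('v) / 4, 1 / 2}"
    by auto
qed

lemma linear_mult_incidence: "linear (\<lambda>y :: real^('v::card2). y v* incidence_matrix)"
  using matrix_vector_mul_linear[of "transpose (incidence_matrix :: real^('v edge)^('v::card2))"]
  by simp

lemma inj_mult_incidence:
  assumes "CARD('v::card2) \<ge> 3"
  shows "inj (\<lambda>y :: real^('v::card2). y v* incidence_matrix)"
proof -
  have "y = 0" if "y v* incidence_matrix = 0" for y :: "real^('v::card2)"
  proof -
    have "(real CARD('v) - 1) * (ones \<bullet> y) = 0"
      by (simp flip: ones_inner_mult_incidence add: that)
    then have "ones \<bullet> y = 0"
      using assms by simp
    then have "(real CARD('v) - 2) *\<^sub>R y = 0"
      using incidence_mult_transpose[of y] that by simp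
    then show ?thesis
      using assms by simp
  qed
  then show ?thesis
    by (simp add: linear_injective_0[OF linear_mult_incidence])
qed

lemma dim_mult_incidence_image:
  fixes S :: "(real^('v::card2)) set"
  assumes "CARD('v) \<ge> 3"
  shows "dim ((\<lambda>y. y v* incidence_matrix) ` S) = dim S"
  by (intro dim_image_eq linear_mult_incidence inj_on_subset[OF inj_mult_incidence[OF assms]]) auto

lemma multiplicity_GK_large:
  fixes \<sigma> :: "'v::card2 edge \<Rightarrow> 'v \<times> 'v"
  assumes "CARD('v) \<ge> 3" and "is_orientation \<sigma>"
  shows "multiplicity_on (GK \<sigma>) ({ones}\<^sup>\<bottom>) (real CARD('v) / 4) = CARD('v) - 1"
proof -
  let ?n = "real CARD('v)" and ?E = "eigenspace_on (GK \<sigma>) ({ones}\<^sup>\<bottom>) (real CARD('v) / 4)"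
  let ?B = "\<lambda>y :: real^('v::card2). y v* incidence_matrix"
  have "?E = ?B ` HK"
  proof (intro equalityI subsetI)
    fix x assume "x \<in> ?E"
    then have x: "ones \<bullet> x = 0" "?B (incidence_matrix *v x) = (?n - 2) *\<^sub>R x"
      by (auto simp: eigenspace_GK_iff[OF assms(2)])
    \<comment> \<open>The eigenvalue equation itself displays \<open>x\<close> as an image under \<open>M\<^sup>T\<close>.\<close>
    define y where "y = (1 / (?n - 2)) *\<^sub>R (incidence_matrix *v x)"
    have "x = ?B y"
      using assms(1) x(2) unfolding y_def
      by (simp add: scaleR_vector_matrix_assoc)
    moreover have "y \<in> HK"
      using x(1) by (simp add: HK_def mem_ones_perp_iff y_def ones_inner_incidence_mult)
    ultimately show "x \<in> ?B ` HK"
      by blast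
  next
    fix x assume "x \<in> ?B ` HK"
    then obtain y where y: "ones \<bullet> y = 0" "x = ?B y"
      by (auto simp: HK_def mem_ones_perp_iff)
    then show "x \<in> ?E"
      by (simp add: eigenspace_GK_iff[OF assms(2)] ones_inner_mult_incidence
          incidence_mult_transpose scaleR_vector_matrix_assoc)
  qed
  then show ?thesis
    by (simp add: multiplicity_on_def dim_mult_incidence_image[OF assms(1)] dim_HK)
qed

lemma multiplicity_GK_half:
  fixes \<sigma> :: "'v::card2 edge \<Rightarrow> 'v \<times> 'v"
  assumes "CARD('v) \<ge> 3" and "is_orientation \<sigma>"
  shows "real (multiplicity_on (GK \<sigma>) ({ones}\<^sup>\<bottom>) (1 / 2))
    = real CARD('v) * (real CARD('v) - 3) / 2"
proof -
  let ?E = "eigenspace_on (GK \<sigma>) ({ones}\<^sup>\<bottom>) (1 / 2)"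
  let ?B = "\<lambda>y :: real^('v::card2). y v* incidence_matrix"
  have "x \<in> ?E \<longleftrightarrow> (\<forall>z\<in>range ?B. orthogonal z x)" for x
  proof -
    have "x \<in> ?E \<longleftrightarrow> incidence_matrix *v x = 0"
      using ones_inner_incidence_mult[of x]
      by (auto simp: eigenspace_GK_iff[OF assms(2)] incidence_gram_zero_iff)
    also have "\<dots> \<longleftrightarrow> (\<forall>y. y \<bullet> (incidence_matrix *v x) = 0)"
      by (metis inner_eq_zero_iff inner_zero_right)
    finally show ?thesis
      by (simp add: orthogonal_def dot_lmul_matrix)
  qed
  then have E: "?E = {x \<in> UNIV. \<forall>z\<in>range ?B. orthogonal z x}"
    by (simp add: set_eq_iff)
  have "dim ?E + dim (range ?B) = dim (UNIV :: (real^('v edge)) set)"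
    unfolding E
    by (intro dim_subspace_orthogonal_to_vectors linear_subspace_image linear_mult_incidence) auto
  then have "dim ?E + CARD('v) = CARD('v edge)"
    by (simp add: dim_mult_incidence_image[OF assms(1)])
  then have "real (dim ?E) = real CARD('v edge) - real CARD('v)"
    by linarith
  then show ?thesis
    by (simp add: multiplicity_on_def CARD_edge_real algebra_simps diff_divide_distrib)
qed

lemma mem_eigenvalues_on_iff:
  "\<mu> \<in> eigenvalues_on A W \<longleftrightarrow> multiplicity_on A W \<mu> \<noteq> 0"
  by (auto simp: eigenvalues_on_def multiplicity_on_def)

lemma gammaK_eq:
  fixes \<sigma> :: "'v::card2 edge \<Rightarrow> 'v \<times> 'v"
  assumes "CARD('v) \<ge> 3" and "is_orientation \<sigma>"
  shows "gammaK \<sigma> = (if CARD('v) = 3 then 3 / 4 else 1 / 2)"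
proof -
  let ?S = "eigenvalues_on (GK \<sigma>) ({ones}\<^sup>\<bottom>)"
  have large: "real CARD('v) / 4 \<in> ?S"
    using assms(1) by (simp add: mem_eigenvalues_on_iff multiplicity_GK_large[OF assms])
  have "real (multiplicity_on (GK \<sigma>) ({ones}\<^sup>\<bottom>) (1 / 2)) \<noteq> 0 \<longleftrightarrow> CARD('v) \<noteq> 3"
    unfolding multiplicity_GK_half[OF assms] by simp
  then have half: "1 / 2 \<in> ?S \<longleftrightarrow> CARD('v) \<noteq> 3"
    by (simp add: mem_eigenvalues_on_iff)
  have sub: "?S \<subseteq> {real CARD('v) / 4, 1 / 2}"
    by (rule eigenvalues_GK_subset[OF assms(2)])
  show ?thesis
  proof (cases "CARD('v) = 3")
    case True
    then have "?S = {3 / 4}"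
      using large half sub by auto
    then show ?thesis
      using True by (simp add: gammaK_def)
  next
    case False
    then have "?S = {real CARD('v) / 4, 1 / 2}"
      using large half sub by blast
    then show ?thesis
      using False assms(1) by (simp add: gammaK_def min_def)
  qed
qed

lemma GK_mult_ones:
  fixes \<sigma> :: "'v::card2 edge \<Rightarrow> 'v \<times> 'v"
  assumes "is_orientation \<sigma>"
  shows "GK \<sigma> *v ones = 0"
proof -
  have n: "real CARD('v) - 1 \<noteq> 0"
    using two_le_card[where 'a = 'v] by simp
  have "(incidence_matrix *v ones) v* incidence_matrix
      = (2 * (real CARD('v) - 1)) *\<^sub>R (ones :: real^('v edge))"
    by (simp add: incidence_mult_ones scaleR_vector_matrix_assoc ones_mult_incidence)
  then show ?thesis
    using n by (simp add: GK_mult_vec[OF assms] ones_inner_ones CARD_edge_real vec_eq_iff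
      field_simps)
qed

lemma GK_preserves_ones_perp:
  fixes \<sigma> :: "'v::card2 edge \<Rightarrow> 'v \<times> 'v"
  assumes "is_orientation \<sigma>" and "x \<in> {ones}\<^sup>\<bottom>"
  shows "GK \<sigma> *v x \<in> {ones}\<^sup>\<bottom>"
proof -
  have x: "ones \<bullet> x = 0"
    using assms(2) by (simp add: mem_ones_perp_iff)
  then have "GK \<sigma> *v x =
      (1 / 4) *\<^sub>R ((incidence_matrix *v x) v* incidence_matrix) + (1 / 2) *\<^sub>R x"
    by (simp add: GK_mult_vec[OF assms(1)])
  then have "ones \<bullet> (GK \<sigma> *v x) = 0"
    by (simp add: inner_add_right ones_inner_mult_incidence ones_inner_incidence_mult x)
  then show ?thesis
    by (simp add: mem_ones_perp_iff)
qed

theorem lemma4p1: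
  fixes \<sigma> :: "'v::card2 edge \<Rightarrow> 'v \<times> 'v"
  assumes "CARD('v) \<ge> 3"
    and "is_orientation \<sigma>"
  shows "unit_norm_tight_frame HK (edge_vec \<sigma>)
    \<and> GK \<sigma> *v ones = 0
    \<and> (\<forall>x\<in>{ones}\<^sup>\<bottom>. GK \<sigma> *v x \<in> {ones}\<^sup>\<bottom>)
    \<and> eigenvalues_on (GK \<sigma>) ({ones}\<^sup>\<bottom>) \<subseteq> {real CARD('v) / 4, 1 / 2}
    \<and> multiplicity_on (GK \<sigma>) ({ones}\<^sup>\<bottom>) (real CARD('v) / 4) = CARD('v) - 1
    \<and> real (multiplicity_on (GK \<sigma>) ({ones}\<^sup>\<bottom>) (1 / 2))
        = real CARD('v) * (real CARD('v) - 3) / 2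
    \<and> gammaK \<sigma> = (if CARD('v) = 3 then 3 / 4 else 1 / 2)"
  using unit_norm_tight_frame_edge_vec[OF assms(2)] GK_mult_ones[OF assms(2)]
    GK_preserves_ones_perp[OF assms(2)] eigenvalues_GK_subset[OF assms(2)]
    multiplicity_GK_large[OF assms] multiplicity_GK_half[OF assms] gammaK_eq[OF assms]
  by blast

end
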